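(* Suppose the mean vectors $\mu_{\tilde c},\mu_{\tilde d^k}$ and upper and lower bound vectors $\tilde c^u,\tilde c^l$ of $\tilde c$ and $\tilde d^{ku},\tilde d^{kl}$ of $\tilde d^k$, $k\in\mathbb{K}$, are known. Let $\lambda_c^{rc}>0$, $\lambda_d^{rc}>0$ be constants, let $N$ be a fixed positive integer, $\mathcal{N}=\{1,\dots,N\}$, for each $k\in\mathbb{K}$ let $y_k^1<y_k^2<\dots<y_k^N$ be points chosen from $[0,1]$, and put $$a_k^i=p_1^{(y_k^i)^{1/\theta}}\Big(1-\frac{(y_k^i)^{1/\theta}}{\theta}\ln p_1\Big),\qquad b_k^i=p_1^{(y_k^i)^{1/\theta}}\,\frac{(y_k^i)^{\frac1\theta-1}}{\theta}\ln p_1,\qquad i\in\mathcal{N},\ k\in\mathbb{K}.$$ Then the optimal value of the following LP problem is a lower bound to the optimal value of the individual chance-constrained problem (ICCP) defined in the context: $$\min_{z,\rho,(\bar y_k)_{k\in\mathbb{K}},\mathfrak{m}_c^{rc},\mathfrak{m}_d^{rc}} z\quad\text{subject to}$$ $$\rho^T\mu_{\tilde c}-z\le(1-p_0)\mathfrak{m}_c^{rc},\quad \lambda_c^{rc}\le\mathfrak{m}_c^{rc},\quad \rho^T\tilde c^u-z\le\mathfrak{m}_c^{rc},\quad \rho^T\tilde c^l\le z,$$ $$\rho^T\mu_{\tilde d^k}-\xi_k+a_k^i\,\mathfrak{m}_d^{rc}+b_k^i\,\bar y_k\le\mathfrak{m}_d^{rc}\quad\forall i\in\mathcal{N},\ k\in\mathbb{K},$$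 $$\lambda_d^{rc}\le\mathfrak{m}_d^{rc},\quad \rho^T\tilde d^{ku}-\xi_k\le\mathfrak{m}_d^{rc},\quad \rho^T\tilde d^{kl}\le\xi_k\quad\forall k\in\mathbb{K},$$ $$\sum_{k\in\mathbb{K}}\bar y_k=\mathfrak{m}_d^{rc},\quad \bar y_k\ge0\ \ \forall k\in\mathbb{K},\quad\rho\in\mathcal{Q}^\alpha(\gamma).$$
   Context: $S$ is a finite nonempty state space, $A(s)$ a finite nonempty action set for each $s\in S$, $\mathcal{K}=\{(s,a): s\in S,\ a\in A(s)\}$, $\alpha\in(0,1)$ a discount factor, $\gamma$ a probability distribution on $S$, $p(s'|s,a)$ known transition probabilities, and $\delta$ the Kronecker delta. Define $$\mathcal{Q}^\alpha(\gamma)=\Big\{\rho\in\mathbb{R}^{|\mathcal{K}|}:\ \sum_{(s,a)\in\mathcal{K}}\rho(s,a)\big(\delta(s',s)-\alpha p(s'|s,a)\big)=(1-\alpha)\gamma(s')\ \forall s'\in S,\ \ \rho(s,a)\ge 0\ \forall (s,a)\in\mathcal{K}\Big\}.$$ Let $\mathbb{K}=\{1,\dots,K\}$, $\xi_k\in\mathbb{R}$, $p_0,p_1\in(0,1)$, $\theta\ge1$. The running cost vectors $\tilde c=(\tilde c(s,a))_{(s,a)\in\mathcal{K}}$ and $\tilde d^k=(\tilde d^k(s,a))_{(s,a)\in\mathcal{K}}$, $k\in\mathbb{K}$, are random vectors on a probability space $(\Omega,\mathcal{F},\mathbb{P})$. The individual chance-constrained problem is $$(\mathrm{ICCP})\quad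 \min_{z,\rho,(y_k)_{k\in\mathbb{K}}} z\ \ \text{s.t.}\ \ \mathbb{P}(\rho^T\tilde c\le z)\ge p_0,\quad \mathbb{P}(\rho^T\tilde d^k\le\xi_k)\ge p_1^{y_k^{1/\theta}}\ \forall k\in\mathbb{K},\quad \rho\in\mathcal{Q}^\alpha(\gamma),\ \sum_{k\in\mathbb{K}}y_k=1,\ y_k\ge0\ \forall k\in\mathbb{K}.$$ Conventions: the optimal value of a minimization problem is the infimum of its objective over its feasible set ($+\infty$ if infeasible). "Upper/lower bound vectors" means $\tilde c^l(s,a)\le\tilde c(s,a)\le\tilde c^u(s,a)$ for all $(s,a)$ and all realizations; similarly for $\tilde d^{ku},\tilde d^{kl}$.
   Formalization: The points y_k^i are taken in (0,1] when θ > 1, since for y_k^i = 0 and θ > 1 the coefficient b_k^i contains 0 to the negative power 1/θ − 1 and is undefined; for θ = 1 the point 0 is allowed, with 0^0 = 1. *)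

theory Defs
  imports "HOL-Probability.Probability"
begin

definition opt_value :: "('x \<Rightarrow> real) \<Rightarrow> 'x set \<Rightarrow> ereal" where
  "opt_value f X = (INF x\<in>X. ereal (f x))"

definition dotp :: "'i set \<Rightarrow> ('i \<Rightarrow> real) \<Rightarrow> ('i \<Rightarrow> real) \<Rightarrow> real" where
  "dotp I u v = (\<Sum>i\<in>I. u i * v i)"

text \<open>Vectors over a finite index set \<open>I\<close> are the functions in \<open>extensional I\<close>, which are in
  bijection with the real vectors indexed by \<open>I\<close>.\<close>

definition occ_measures ::
  "'s set \<Rightarrow> ('s \<Rightarrow> 'a set) \<Rightarrow> ('s \<Rightarrow> 'a \<Rightarrow> 's \<Rightarrow> real) \<Rightarrow> real \<Rightarrow> ('s \<Rightarrow> real) \<Rightarrow> ('s \<times> 'a \<Rightarrow> real) set" where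
  "occ_measures S A p \<alpha> \<gamma> =
    {\<rho> \<in> extensional (Sigma S A).
      (\<forall>s'\<in>S. (\<Sum>(s,a)\<in>Sigma S A. \<rho> (s,a) * ((if s' = s then 1 else 0) - \<alpha> * p s a s'))
                = (1 - \<alpha>) * \<gamma> s') \<and>
      (\<forall>(s,a)\<in>Sigma S A. \<rho> (s,a) \<ge> 0)}"

text \<open>In \<open>iccp_feasible\<close> and \<open>lp_feasible\<close>, \<open>X\<close> is the set of state-action pairs and \<open>Q\<close> the set
  of admissible vectors over \<open>X\<close>.\<close>

definition iccp_feasible ::
  "'w measure \<Rightarrow> 'x set \<Rightarrow> ('x \<Rightarrow> real) set \<Rightarrow> nat \<Rightarrow> real \<Rightarrow> real \<Rightarrow> real \<Rightarrow> (nat \<Rightarrow> real) \<Rightarrow>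
   ('x \<Rightarrow> 'w \<Rightarrow> real) \<Rightarrow> (nat \<Rightarrow> 'x \<Rightarrow> 'w \<Rightarrow> real) \<Rightarrow>
   (real \<times> ('x \<Rightarrow> real) \<times> (nat \<Rightarrow> real)) set" where
  "iccp_feasible M X Q K p0 p1 \<theta> \<xi> c d =
    {(z, \<rho>, y).
      measure M {\<omega> \<in> space M. dotp X \<rho> (\<lambda>x. c x \<omega>) \<le> z} \<ge> p0 \<and>
      (\<forall>k\<in>{1..K}. measure M {\<omega> \<in> space M. dotp X \<rho> (\<lambda>x. d k x \<omega>) \<le> \<xi> k}
                      \<ge> p1 powr (y k powr (1 / \<theta>))) \<and>
      \<rho> \<in> Q \<and>
      y \<in> extensional {1..K} \<and>
      (\<Sum>k\<in>{1..K}. y k) = 1 \<and>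
      (\<forall>k\<in>{1..K}. y k \<ge> 0)}"

text \<open>The library has \<open>0 powr 0 = 0\<close>; the slope below needs the value 1 when \<open>\<theta> = 1\<close> and \<open>y = 0\<close>.\<close>

definition rpow :: "real \<Rightarrow> real \<Rightarrow> real" where
  "rpow x r = (if r = 0 then 1 else x powr r)"

text \<open>Intercept and slope of the tangent to \<open>p1 powr (y powr (1 / \<theta>))\<close> as a function of \<open>y\<close>. For
  \<open>\<theta> > 1\<close> the slope is meaningful only at \<open>y > 0\<close>.\<close>

definition tangent_a :: "real \<Rightarrow> real \<Rightarrow> real \<Rightarrow> real" where
  "tangent_a p1 \<theta> y = p1 powr (y powr (1 / \<theta>)) * (1 - y powr (1 / \<theta>) / \<theta> * ln p1)"

definition tangent_b :: "real \<Rightarrow> real \<Rightarrow> real \<Rightarrow> real" where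
  "tangent_b p1 \<theta> y = p1 powr (y powr (1 / \<theta>)) * (rpow y (1 / \<theta> - 1) / \<theta>) * ln p1"

definition lp_feasible ::
  "'x set \<Rightarrow> ('x \<Rightarrow> real) set \<Rightarrow> nat \<Rightarrow> nat \<Rightarrow> real \<Rightarrow> (nat \<Rightarrow> real) \<Rightarrow>
   ('x \<Rightarrow> real) \<Rightarrow> ('x \<Rightarrow> real) \<Rightarrow> ('x \<Rightarrow> real) \<Rightarrow>
   (nat \<Rightarrow> 'x \<Rightarrow> real) \<Rightarrow> (nat \<Rightarrow> 'x \<Rightarrow> real) \<Rightarrow> (nat \<Rightarrow> 'x \<Rightarrow> real) \<Rightarrow>
   (nat \<Rightarrow> nat \<Rightarrow> real) \<Rightarrow> (nat \<Rightarrow> nat \<Rightarrow> real) \<Rightarrow> real \<Rightarrow> real \<Rightarrow>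
   (real \<times> ('x \<Rightarrow> real) \<times> (nat \<Rightarrow> real) \<times> real \<times> real) set" where
  "lp_feasible X Q K N p0 \<xi> mu_c cl cu mu_d dl du a b lam_c lam_d =
    {(z, \<rho>, ybar, mc, md).
      dotp X \<rho> mu_c - z \<le> (1 - p0) * mc \<and>
      lam_c \<le> mc \<and>
      dotp X \<rho> cu - z \<le> mc \<and>
      dotp X \<rho> cl \<le> z \<and>
      (\<forall>i\<in>{1..N}. \<forall>k\<in>{1..K}. dotp X \<rho> (mu_d k) - \<xi> k + a k i * md + b k i * ybar k \<le> md) \<and>
      lam_d \<le> md \<and>
      (\<forall>k\<in>{1..K}. dotp X \<rho> (du k) - \<xi> k \<le> md) \<and>
      (\<forall>k\<in>{1..K}. dotp X \<rho> (dl k) \<le> \<xi> k) \<and>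
      ybar \<in> extensional {1..K} \<and>
      (\<Sum>k\<in>{1..K}. ybar k) = md \<and>
      (\<forall>k\<in>{1..K}. ybar k \<ge> 0) \<and>
      \<rho> \<in> Q}"

end

theory Submission
  imports Defs
begin

text \<open>
  Every feasible point \<open>(z, \<rho>, y)\<close> of the chance-constrained problem yields a feasible point of the
  linear program with the same objective value \<open>z\<close>; comparing infima gives the bound.

  The probabilistic ingredient is the estimate \<open>expectation_minus_threshold_le\<close>: if a random
  variable \<open>f\<close> exceeds \<open>z\<close> by at most \<open>m \<ge> 0\<close>, then \<open>f - z\<close> is dominated by \<open>m\<close> times the
  indicator of \<open>f > z\<close>, so \<open>P(f \<le> z) \<ge> q\<close> forces \<open>E f - z \<le> (1 - q) m\<close>. Hence \<open>m\<^sub>c\<close> and \<open>m\<^sub>d\<close> are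
  chosen as the largest excess of the upper cost bounds over the thresholds, raised to the constants
  \<open>\<lambda>\<close> if necessary. The lower-bound constraints hold because an event of positive probability is nonempty.

  For the constraints on the costs \<open>d\<^sup>k\<close> the level \<open>q\<close> is \<open>p\<^sub>1\<close> to the power \<open>y\<^sub>k\<close> to the power \<open>1/\<theta>\<close>.
  It is a convex function of \<open>y\<^sub>k\<close>, being a decreasing convex function of a concave one, and so it
  lies above each of its tangents (\<open>tangent_le_level\<close>). Replacing it by the tangent and
  multiplying by \<open>m\<^sub>d\<close> turns the product \<open>m\<^sub>d y\<^sub>k\<close> into the single variable \<open>ybar\<^sub>k\<close>, which makes the
  constraint linear; correspondingly, the witness is \<open>ybar = m\<^sub>d y\<close>, whose entries sum to \<open>m\<^sub>d\<close>
  because those of \<open>y\<close> sum to 1.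
\<close>

text \<open>
  The tangent of the concave function \<open>x powr r\<close> lies above its graph. For \<open>x, y > 0\<close>, after division by
  \<open>y powr r\<close>, this is the weighted inequality of the arithmetic and geometric means for
  \<open>x / y\<close> and \<open>1\<close>. For \<open>r = 1\<close> the base point \<open>y\<close> may be 0, provided the slope there is read as 1.
\<close>

lemma powr_le_tangent:
  fixes x y r :: real
  assumes "0 \<le> x" "0 \<le> y" "0 < r" "r \<le> 1" and base: "y = 0 \<longrightarrow> r = 1"
  shows "x powr r \<le> y powr r + r * rpow y (r - 1) * (x - y)"
proof (cases "r = 1")
  case True
  then show ?thesis using assms by (simp add: rpow_def)
next
  case False
  with assms have y: "y > 0" and r: "r < 1" by auto
  have "(x / y) powr r \<le> 1 + r * (x / y - 1)"
  proof (cases "x = 0")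
    case False
    then have "(x / y) powr r * 1 powr (1 - r) \<le> r * (x / y) + (1 - r) * 1"
      using assms y by (intro Youngs_inequality_0) auto
    then show ?thesis by (simp add: algebra_simps)
  qed (use r in simp)
  then have "y powr r * (x / y) powr r \<le> y powr r * (1 + r * (x / y - 1))"
    by (intro mult_left_mono) auto
  also have "y powr r * (x / y) powr r = x powr r"
    using y assms by (simp add: powr_divide)
  also have "y powr r * (1 + r * (x / y - 1)) = y powr r + r * (y powr r / y) * (x - y)"
    using y by (simp add: field_simps)
  also have "y powr r / y = rpow y (r - 1)"
    using y r by (simp add: rpow_def powr_diff)
  finally show ?thesis .
qed

text \<open>
  The exponential \<open>p1 powr u\<close> lies above its tangent in \<open>u\<close>; since \<open>ln p1 < 0\<close>, the upper bound of
  \<open>powr_le_tangent\<close> on \<open>u = y powr (1 / \<theta>)\<close> can be inserted there.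
\<close>

lemma tangent_le_level:
  fixes p1 \<theta> y t :: real
  assumes "0 < p1" "p1 < 1" "\<theta> \<ge> 1" "0 \<le> y" "0 \<le> t" and base: "t = 0 \<longrightarrow> \<theta> = 1"
  shows "tangent_a p1 \<theta> t + tangent_b p1 \<theta> t * y \<le> p1 powr (y powr (1 / \<theta>))"
proof -
  define r u v where "r = 1 / \<theta>" and "u = y powr r" and "v = t powr r"
  have r: "0 < r" "r \<le> 1" "t = 0 \<longrightarrow> r = 1"
    using assms by (auto simp: r_def)
  have ln: "ln p1 < 0" using assms by simp
  \<comment> \<open>This identity identifies the intercept in \<open>tangent_a\<close> as value minus slope times \<open>t\<close>;
    it also holds at \<open>t = 0\<close>, where both sides vanish.\<close>
  have t_slope: "rpow t (r - 1) * t = v"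
  proof (cases "t = 0")
    case False
    then show ?thesis using assms by (auto simp: rpow_def v_def powr_diff)
  qed (use r in \<open>simp add: v_def\<close>)
  have "u - v \<le> r * rpow t (r - 1) * (y - t)"
    using powr_le_tangent[OF \<open>0 \<le> y\<close> \<open>0 \<le> t\<close> r] by (simp add: u_def v_def)
  then have "1 + r * rpow t (r - 1) * (y - t) * ln p1 \<le> 1 + (u - v) * ln p1"
    using ln by (simp add: mult_right_mono_neg)
  also have "\<dots> \<le> exp ((u - v) * ln p1)"
    by (rule exp_ge_add_one_self)
  also have "\<dots> = p1 powr (u - v)"
    using assms by (simp add: powr_def)
  finally have "p1 powr v * (1 + r * rpow t (r - 1) * (y - t) * ln p1) \<le> p1 powr v * p1 powr (u - v)"
    by (intro mult_left_mono) auto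
  also have "\<dots> = p1 powr u"
    by (simp flip: powr_add)
  also have "p1 powr v * (1 + r * rpow t (r - 1) * (y - t) * ln p1)
      = p1 powr v * (1 + (r * rpow t (r - 1) * y - r * (rpow t (r - 1) * t)) * ln p1)"
    by (simp add: algebra_simps)
  also have "\<dots> = tangent_a p1 \<theta> t + tangent_b p1 \<theta> t * y"
    unfolding t_slope tangent_a_def tangent_b_def
    by (simp add: v_def r_def algebra_simps)
  finally show ?thesis by (simp add: u_def r_def)
qed

lemma (in prob_space) expectation_minus_threshold_le:
  fixes f :: "'a \<Rightarrow> real"
  assumes f: "integrable M f"
    and excess: "\<And>\<omega>. \<omega> \<in> space M \<Longrightarrow> f \<omega> - z \<le> m" and "0 \<le> m"
    and level: "q \<le> prob {\<omega> \<in> space M. f \<omega> \<le> z}"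
  shows "expectation f - z \<le> (1 - q) * m"
proof -
  let ?E = "{\<omega> \<in> space M. f \<omega> \<le> z}"
  have [measurable]: "f \<in> borel_measurable M" using f by simp
  have E: "?E \<in> events" by measurable
  have int: "integrable M (\<lambda>\<omega>. m * indicator (space M - ?E) \<omega>)"
    using E by (intro integrable_mult_right integrable_real_indicator) (auto simp: emeasure_eq_measure)
  have "expectation f - z = expectation (\<lambda>\<omega>. f \<omega> - z)"
    using f by (simp add: prob_space)
  also have "\<dots> \<le> expectation (\<lambda>\<omega>. m * indicator (space M - ?E) \<omega>)"
    using f int excess \<open>0 \<le> m\<close> by (intro integral_mono) (auto simp: indicator_def)
  also have "\<dots> = m * prob (space M - ?E)"
    using E by simp
  also have "\<dots> = m * (1 - prob ?E)"
    using E by (simp add: prob_compl)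
  also have "\<dots> \<le> m * (1 - q)"
    using level \<open>0 \<le> m\<close> by (intro mult_left_mono) auto
  finally show ?thesis by (simp add: mult.commute)
qed

lemma (in prob_space) lower_bound_le_threshold:
  fixes f :: "'a \<Rightarrow> real"
  assumes lower: "\<And>\<omega>. \<omega> \<in> space M \<Longrightarrow> l \<le> f \<omega>"
    and "0 < q" and level: "q \<le> prob {\<omega> \<in> space M. f \<omega> \<le> z}"
  shows "l \<le> z"
proof (rule ccontr)
  assume "\<not> l \<le> z"
  then have empty: "{\<omega> \<in> space M. f \<omega> \<le> z} = {}"
    using lower by force
  show False
    using level \<open>0 < q\<close> unfolding empty by simp
qed

lemma dotp_mono:
  assumes "\<And>i. i \<in> I \<Longrightarrow> 0 \<le> u i" "\<And>i. i \<in> I \<Longrightarrow> v i \<le> w i"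
  shows "dotp I u v \<le> dotp I u w"
  unfolding dotp_def by (intro sum_mono mult_left_mono assms)

text \<open>
  Both kinds of chance constraints, on the objective and on each \<open>d\<^sup>k\<close>, imply the linear
  constraints through this lemma, with the threshold \<open>t\<close> being \<open>z\<close> or \<open>\<xi>\<^sub>k\<close>.
\<close>

lemma (in prob_space) chance_constraint_linear_consequences:
  fixes \<rho> :: "'x \<Rightarrow> real" and X :: "'x set" and g :: "'x \<Rightarrow> 'a \<Rightarrow> real"
  assumes \<rho>: "\<And>x. x \<in> X \<Longrightarrow> 0 \<le> \<rho> x"
    and meas: "\<And>x. x \<in> X \<Longrightarrow> g x \<in> borel_measurable M"
    and mean: "\<And>x. x \<in> X \<Longrightarrow> mu x = expectation (g x)"
    and lower: "\<And>x \<omega>. x \<in> X \<Longrightarrow> \<omega> \<in> space M \<Longrightarrow> l x \<le> g x \<omega>"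
    and upper: "\<And>x \<omega>. x \<in> X \<Longrightarrow> \<omega> \<in> space M \<Longrightarrow> g x \<omega> \<le> h x"
    and level: "q \<le> prob {\<omega> \<in> space M. dotp X \<rho> (\<lambda>x. g x \<omega>) \<le> t}" and "0 < q"
    and excess: "dotp X \<rho> h - t \<le> m" and "0 \<le> m"
  shows "dotp X \<rho> mu - t \<le> (1 - q) * m" and "dotp X \<rho> l \<le> t"
proof -
  let ?f = "\<lambda>\<omega>. dotp X \<rho> (\<lambda>x. g x \<omega>)"
  have int: "integrable M (g x)" if "x \<in> X" for x
  proof (rule integrable_const_bound[where B = "max \<bar>l x\<bar> \<bar>h x\<bar>"])
    have "norm (g x \<omega>) \<le> max \<bar>l x\<bar> \<bar>h x\<bar>" if "\<omega> \<in> space M" for \<omega>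
      using lower[OF \<open>x \<in> X\<close> that] upper[OF \<open>x \<in> X\<close> that] unfolding real_norm_def by linarith
    then show "AE \<omega> in M. norm (g x \<omega>) \<le> max \<bar>l x\<bar> \<bar>h x\<bar>" by (rule AE_I2)
  qed (rule meas[OF that])
  have "expectation ?f = (\<Sum>x\<in>X. \<rho> x * expectation (g x))"
    unfolding dotp_def by (subst Bochner_Integration.integral_sum) (auto intro: int)
  also have "\<dots> = dotp X \<rho> mu"
    unfolding dotp_def by (intro sum.cong) (auto simp: mean)
  finally have f_mean: "expectation ?f = dotp X \<rho> mu" .
  have f_int: "integrable M ?f"
    unfolding dotp_def by (intro Bochner_Integration.integrable_sum integrable_mult_right int)
  have f_excess: "?f \<omega> - t \<le> m" if "\<omega> \<in> space M" for \<omega>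
  proof -
    have "?f \<omega> \<le> dotp X \<rho> h" using that by (intro dotp_mono \<rho> upper)
    with excess show ?thesis by simp
  qed
  show "dotp X \<rho> mu - t \<le> (1 - q) * m"
    using expectation_minus_threshold_le[OF f_int f_excess \<open>0 \<le> m\<close> level] by (simp add: f_mean)
  have "dotp X \<rho> l \<le> ?f \<omega>" if "\<omega> \<in> space M" for \<omega>
    using that by (intro dotp_mono \<rho> lower)
  then show "dotp X \<rho> l \<le> t"
    using \<open>0 < q\<close> level by (rule lower_bound_le_threshold)
qed

theorem theorem7:
  fixes S :: "'s set" and A :: "'s \<Rightarrow> 'a set"
    and p :: "'s \<Rightarrow> 'a \<Rightarrow> 's \<Rightarrow> real" and \<gamma> :: "'s \<Rightarrow> real"
    and \<alpha> p0 p1 \<theta> lam_c lam_d :: real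
    and K N :: nat and \<xi> :: "nat \<Rightarrow> real"
    and M :: "'w measure"
    and c :: "'s \<times> 'a \<Rightarrow> 'w \<Rightarrow> real" and d :: "nat \<Rightarrow> 's \<times> 'a \<Rightarrow> 'w \<Rightarrow> real"
    and mu_c cl cu :: "'s \<times> 'a \<Rightarrow> real" and mu_d dl du :: "nat \<Rightarrow> 's \<times> 'a \<Rightarrow> real"
    and Y a b :: "nat \<Rightarrow> nat \<Rightarrow> real"
  assumes "finite S" "S \<noteq> {}"
    and "\<forall>s\<in>S. finite (A s) \<and> A s \<noteq> {}"
    and "\<forall>s\<in>S. \<forall>a\<in>A s. (\<forall>s'\<in>S. 0 \<le> p s a s') \<and> (\<Sum>s'\<in>S. p s a s') = 1"
    and "\<forall>s\<in>S. 0 \<le> \<gamma> s" "(\<Sum>s\<in>S. \<gamma> s) = 1"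
    and "0 < \<alpha>" "\<alpha> < 1"
    and "K \<ge> 1" "N \<ge> 1"
    and "0 < p0" "p0 < 1" "0 < p1" "p1 < 1" "\<theta> \<ge> 1"
    and "prob_space M"
    and "\<forall>x\<in>Sigma S A. c x \<in> borel_measurable M"
    and "\<forall>k\<in>{1..K}. \<forall>x\<in>Sigma S A. d k x \<in> borel_measurable M"
    and "\<forall>x\<in>Sigma S A. mu_c x = prob_space.expectation M (c x)"
    and "\<forall>k\<in>{1..K}. \<forall>x\<in>Sigma S A. mu_d k x = prob_space.expectation M (d k x)"
    and "\<forall>x\<in>Sigma S A. \<forall>\<omega>\<in>space M. cl x \<le> c x \<omega> \<and> c x \<omega> \<le> cu x"
    and "\<forall>k\<in>{1..K}. \<forall>x\<in>Sigma S A. \<forall>\<omega>\<in>space M. dl k x \<le> d k x \<omega> \<and> d k x \<omega> \<le> du k x"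
    and "lam_c > 0" "lam_d > 0"
    and "\<forall>k\<in>{1..K}. strict_mono_on {1..N} (Y k)"
    and "\<forall>k\<in>{1..K}. \<forall>i\<in>{1..N}. Y k i \<in> {0..1}"
    and slope_defined: "\<forall>k\<in>{1..K}. \<forall>i\<in>{1..N}. Y k i = 0 \<longrightarrow> \<theta> = 1"
    and "\<forall>k\<in>{1..K}. \<forall>i\<in>{1..N}. a k i = tangent_a p1 \<theta> (Y k i)"
    and "\<forall>k\<in>{1..K}. \<forall>i\<in>{1..N}. b k i = tangent_b p1 \<theta> (Y k i)"
  shows "opt_value fst (lp_feasible (Sigma S A) (occ_measures S A p \<alpha> \<gamma>) K N p0 \<xi>
                          mu_c cl cu mu_d dl du a b lam_c lam_d)
       \<le> opt_value fst (iccp_feasible M (Sigma S A) (occ_measures S A p \<alpha> \<gamma>) K p0 p1 \<theta> \<xi> c d)"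
proof -
  interpret prob_space M by fact
  define X Q where "X = Sigma S A" and "Q = occ_measures S A p \<alpha> \<gamma>"
  define LP where "LP = lp_feasible X Q K N p0 \<xi> mu_c cl cu mu_d dl du a b lam_c lam_d"
  define ICCP where "ICCP = iccp_feasible M X Q K p0 p1 \<theta> \<xi> c d"
  have c_facts:
    "\<And>x. x \<in> X \<Longrightarrow> c x \<in> borel_measurable M" "\<And>x. x \<in> X \<Longrightarrow> mu_c x = expectation (c x)"
    "\<And>x \<omega>. x \<in> X \<Longrightarrow> \<omega> \<in> space M \<Longrightarrow> cl x \<le> c x \<omega>"
    "\<And>x \<omega>. x \<in> X \<Longrightarrow> \<omega> \<in> space M \<Longrightarrow> c x \<omega> \<le> cu x"
    unfolding X_def using assms(17,19,21) by blast+
  have d_facts: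
    "\<And>x. x \<in> X \<Longrightarrow> d k x \<in> borel_measurable M" "\<And>x. x \<in> X \<Longrightarrow> mu_d k x = expectation (d k x)"
    "\<And>x \<omega>. x \<in> X \<Longrightarrow> \<omega> \<in> space M \<Longrightarrow> dl k x \<le> d k x \<omega>"
    "\<And>x \<omega>. x \<in> X \<Longrightarrow> \<omega> \<in> space M \<Longrightarrow> d k x \<omega> \<le> du k x" if "k \<in> {1..K}" for k
    unfolding X_def using assms(18,20,22) that by blast+
  have witness: "\<exists>w\<in>LP. fst w = fst v" if v_in: "v \<in> ICCP" for v
  proof -
    obtain z \<rho> y where v: "v = (z, \<rho>, y)" by (cases v) auto
    have obj: "p0 \<le> prob {\<omega> \<in> space M. dotp X \<rho> (\<lambda>x. c x \<omega>) \<le> z}"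
      and con: "\<And>k. k \<in> {1..K} \<Longrightarrow>
        p1 powr (y k powr (1 / \<theta>)) \<le> prob {\<omega> \<in> space M. dotp X \<rho> (\<lambda>x. d k x \<omega>) \<le> \<xi> k}"
      and \<rho>: "\<rho> \<in> Q" and y_sum: "(\<Sum>k\<in>{1..K}. y k) = 1"
      and y_nonneg: "\<And>k. k \<in> {1..K} \<Longrightarrow> 0 \<le> y k"
      using v_in by (auto simp: ICCP_def iccp_feasible_def v)
    have \<rho>_nonneg: "0 \<le> \<rho> x" if "x \<in> X" for x
      using \<rho> that by (auto simp: Q_def X_def occ_measures_def)

    define mc where "mc = max lam_c (dotp X \<rho> cu - z)"
    \<comment> \<open>A single \<open>md\<close> serves all \<open>k\<close>, hence the maximum over \<open>k\<close>.\<close>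
    define md where "md = Max (insert lam_d ((\<lambda>k. dotp X \<rho> (du k) - \<xi> k) ` {1..K}))"
    define ybar where "ybar = (\<lambda>k\<in>{1..K}. md * y k)"
    have mc: "lam_c \<le> mc" "dotp X \<rho> cu - z \<le> mc" "0 \<le> mc"
      using \<open>lam_c > 0\<close> by (auto simp: mc_def)
    have lam_d: "lam_d \<le> md" unfolding md_def by (intro Max_ge) auto
    have md: "0 \<le> md" using lam_d \<open>lam_d > 0\<close> by simp
    have du: "dotp X \<rho> (du k) - \<xi> k \<le> md" if "k \<in> {1..K}" for k
      unfolding md_def using that by (intro Max_ge) auto

    have level_pos: "0 < p1 powr (y k powr (1 / \<theta>))" for k
      using \<open>0 < p1\<close> by simp
    have c_lin: "dotp X \<rho> mu_c - z \<le> (1 - p0) * mc" "dotp X \<rho> cl \<le> z"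
      by (rule chance_constraint_linear_consequences
          [where g = c and l = cl and h = cu and mu = mu_c and q = p0];
          use \<rho>_nonneg obj mc \<open>0 < p0\<close> c_facts in blast)+
    have d_lin: "dotp X \<rho> (mu_d k) - \<xi> k \<le> (1 - p1 powr (y k powr (1 / \<theta>))) * md"
      "dotp X \<rho> (dl k) \<le> \<xi> k" if k: "k \<in> {1..K}" for k
      by (rule chance_constraint_linear_consequences
          [where g = "d k" and l = "dl k" and h = "du k" and mu = "mu_d k"
             and q = "p1 powr (y k powr (1 / \<theta>))"];
          use \<rho>_nonneg con[OF k] du[OF k] md level_pos[of k] d_facts[OF k] in blast)+

    have d_tangent: "dotp X \<rho> (mu_d k) - \<xi> k + a k i * md + b k i * ybar k \<le> md"
      if k: "k \<in> {1..K}" and i: "i \<in> {1..N}" for k i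
    proof -
      have "0 \<le> Y k i" "Y k i = 0 \<longrightarrow> \<theta> = 1"
        using assms(26) slope_defined k i by (meson atLeastAtMost_iff)+
      then have "tangent_a p1 \<theta> (Y k i) + tangent_b p1 \<theta> (Y k i) * y k \<le> p1 powr (y k powr (1 / \<theta>))"
        using y_nonneg[OF k] \<open>0 < p1\<close> \<open>p1 < 1\<close> \<open>\<theta> \<ge> 1\<close> by (intro tangent_le_level)
      then have "a k i + b k i * y k \<le> p1 powr (y k powr (1 / \<theta>))"
        using assms(28,29) k i by simp
      then have "(a k i + b k i * y k) * md \<le> p1 powr (y k powr (1 / \<theta>)) * md"
        using md by (rule mult_right_mono)
      moreover have "ybar k = md * y k" using k by (simp add: ybar_def)
      ultimately show ?thesis using d_lin(1)[OF k] by (simp add: algebra_simps)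
    qed
    have ybar: "ybar \<in> extensional {1..K}" "(\<Sum>k\<in>{1..K}. ybar k) = md"
      "\<forall>k\<in>{1..K}. 0 \<le> ybar k"
      using y_sum y_nonneg md by (auto simp: ybar_def simp flip: sum_distrib_left)
    have "(z, \<rho>, ybar, mc, md) \<in> LP"
      unfolding LP_def lp_feasible_def
      using c_lin mc d_tangent lam_d du d_lin(2) ybar \<rho> by auto
    then show ?thesis by (rule bexI[rotated]) (simp add: v)
  qed
  have "opt_value fst LP \<le> opt_value fst ICCP"
    unfolding opt_value_def by (rule INF_mono) (metis witness order_refl)
  then show ?thesis by (simp only: LP_def ICCP_def X_def Q_def)
qed

end
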